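(* Let $Y_i=\sum_{r=1}^n\ell_{ir}\partial_r$, $i\in\{1,\ldots,n\}$, be $n$ linear vector fields in $\mathbb{R}^n$ ($n\ge1$), with $\ell=(\ell_{ir})\in\mathfrak{gl}(n,\mathbb{R}^{n*})$ and $D=\det\ell\neq0$. Let $\mathcal{R}$ and $\mathcal{P}$ be the spaces of real and potential formal cochains. (i) There is a canonical non-surjective injection $i:\mathcal{R}\to\mathcal{P}$ (given by rewriting the $\partial_j$ in terms of the $Y_k$). (ii) A homogeneous potential cochain $D^{-1}\sum_{\mathbf{k}}P^{\mathbf{k}r}Y_{\mathbf{k}}$ of bidegree $(p,r)$ (sum over $\mathbf{k}=(k_1<\cdots<k_p)$, with $P^{\mathbf{k}r}\in\mathcal{S}^r\mathbb{R}^{n*}$) is real, i.e. belongs to $i(\mathcal{R})$, if and only if the $\frac{n!}{p!(n-p)!}$ homogeneous polynomials $\sum_{\mathbf{k}}L^{\mathbf{k}\mathbf{i}}P^{\mathbf{k}r}$ of degree $p+r$, indexed by $\mathbf{i}=(i_1<\cdots<i_p)$, are all divisible by $D$ (for $p=0$ this condition means that $P^r$ is divisible by $D$).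
   Context: $\mathbb{R}^{n*}$ is the space of linear forms on $\mathbb{R}^n$ and $\mathcal{S}^r\mathbb{R}^{n*}$ is the space of homogeneous polynomials of degree $r$ on $\mathbb{R}^n$. $L^{\mathbf{k}\mathbf{i}}$ denotes the minor of $\ell$ at the intersections of the rows $\mathbf{k}$ and the columns $\mathbf{i}$. $Y_{\mathbf{k}}=Y_{k_1}\wedge\cdots\wedge Y_{k_p}$. The space of real formal cochains is $\mathcal{R}=\bigoplus_{p=0}^n\mathbb{R}[[x_1,\ldots,x_n]]\otimes\bigwedge^p\langle\partial_1,\ldots,\partial_n\rangle$, and the space of potential formal cochains is $\mathcal{P}=D^{-1}\bigoplus_{p=0}^n\mathbb{R}[[x_1,\ldots,x_n]]\otimes\bigwedge^p\langle Y_1,\ldots,Y_n\rangle$. Here $\mathcal{P}$ is concretely the space of polyvector fields $\sum_{\mathbf{k}}f^{\mathbf{k}}Y_{\mathbf{k}}$ with coefficients $f^{\mathbf{k}}\in D^{-1}\mathbb{R}[[x_1,\ldots,x_n]]$; both spaces may be viewed inside $\mathrm{Frac}(\mathbb{R}[[x_1,\ldots,x_n]])\otimes\bigwedge\langle\partial_1,\ldots,\partial_n\rangle$, and one has $\partial_j=D^{-1}\sum_k\mathbf{L}_{kj}Y_k$, where $\mathbf{L}$ is the matrix of cofactors of $\ell$. The homogeneous potential cochains of bidegree $(p,r)$ form $\mathcal{P}^{pr}=D^{-1}\,\mathcal{S}^r\mathbb{R}^{n*}\otimes\bigwedge^p\langle Y_1,\ldots,Y_n\rangle$. *)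

theory Defs
  imports
    "HOL-Library.Poly_Mapping"
    "HOL-Library.Cardinality"
    "HOL-Computational_Algebra.Fraction_Field"
    "Jordan_Normal_Form.Determinant"
begin

text \<open>
  The dimension is \<open>n = CARD('n)\<close>, for an arbitrary nonempty finite linearly ordered type
  \<open>'n\<close> playing the role of \<open>{1, \<dots>, n}\<close>; the variables \<open>x\<^sub>i\<close> and the rows and columns of
  \<open>\<ell>\<close> are indexed by \<open>'n\<close>. An increasing multi-index \<open>k\<^sub>1 < \<cdots> < k\<^sub>p\<close> is encoded by the set
  \<open>{k\<^sub>1, \<dots>, k\<^sub>p} :: 'n set\<close>.
\<close>

section \<open>Polynomials and formal power series in the variables \<open>'n\<close>\<close>

type_synonym 'n monomial = "'n \<Rightarrow>\<^sub>0 nat"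
type_synonym 'n mpoly = "'n monomial \<Rightarrow>\<^sub>0 real"

definition mdeg :: "'n::finite monomial \<Rightarrow> nat" where
  "mdeg m = (\<Sum>i\<in>UNIV. Poly_Mapping.lookup m i)"

text \<open>The zero polynomial is homogeneous of every degree, so \<open>{P. homogeneous r P}\<close> is the space
  \<open>\<S>\<^sup>r\<close>; for \<open>r = 1\<close> it is the space of linear forms.\<close>

definition homogeneous :: "nat \<Rightarrow> 'n::finite mpoly \<Rightarrow> bool" where
  "homogeneous r P \<longleftrightarrow> (\<forall>m \<in> Poly_Mapping.keys P. mdeg m = r)"

typedef 'n mfps = "UNIV :: ('n monomial \<Rightarrow> real) set"
  morphisms mfps_coeff Abs_mfps ..

setup_lifting type_definition_mfps

lemma mfps_eqI: "(\<And>m. mfps_coeff f m = mfps_coeff g m) \<Longrightarrow> f = g"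
  by (metis ext mfps_coeff_inject)

lemma finite_bounded_monomials: "finite {a :: 'n::finite monomial. \<forall>i. Poly_Mapping.lookup a i \<le> N}"
proof (rule finite_imageD)
  have "Poly_Mapping.lookup ` {a :: 'n monomial. \<forall>i. Poly_Mapping.lookup a i \<le> N} \<subseteq> (PiE UNIV (\<lambda>_. {..N}))"
    by auto
  then show "finite (Poly_Mapping.lookup ` {a :: 'n monomial. \<forall>i. Poly_Mapping.lookup a i \<le> N})"
    by (rule finite_subset) (simp add: finite_PiE)
  show "inj_on Poly_Mapping.lookup {a :: 'n monomial. \<forall>i. Poly_Mapping.lookup a i \<le> N}"
    by (simp add: inj_on_def poly_mapping_eqI)
qed

lemma lookup_le_mdeg: "Poly_Mapping.lookup m i \<le> mdeg m"
  unfolding mdeg_def by (rule member_le_sum) auto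

lemma mdeg_add: "mdeg (a + b) = mdeg a + mdeg b"
  by (simp add: mdeg_def lookup_add sum.distrib)

lemma finite_mdeg_le: "finite {a :: 'n::finite monomial. mdeg a \<le> d}"
  by (rule finite_subset[OF _ finite_bounded_monomials[of d]])
     (auto intro: order_trans[OF lookup_le_mdeg])

abbreviation splittings :: "'n monomial \<Rightarrow> ('n monomial \<times> 'n monomial) set" where
  "splittings m \<equiv> {(a, b). a + b = m}"

lemma finite_splittings: "finite (splittings (m :: 'n::finite monomial))"
  by (rule finite_subset[of _ "{a. mdeg a \<le> mdeg m} \<times> {a. mdeg a \<le> mdeg m}"])
     (auto simp: mdeg_add finite_mdeg_le)

instantiation mfps :: (finite) comm_ring_1
begin

lift_definition zero_mfps :: "'a mfps" is "\<lambda>_. 0" .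
lift_definition one_mfps :: "'a mfps" is "\<lambda>m. if m = 0 then 1 else 0" .
lift_definition plus_mfps :: "'a mfps \<Rightarrow> 'a mfps \<Rightarrow> 'a mfps" is "\<lambda>f g m. f m + g m" .
lift_definition minus_mfps :: "'a mfps \<Rightarrow> 'a mfps \<Rightarrow> 'a mfps" is "\<lambda>f g m. f m - g m" .
lift_definition uminus_mfps :: "'a mfps \<Rightarrow> 'a mfps" is "\<lambda>f m. - f m" .
lift_definition times_mfps :: "'a mfps \<Rightarrow> 'a mfps \<Rightarrow> 'a mfps"
  is "\<lambda>f g m. \<Sum>(a, b) \<in> splittings m. f a * g b" .

instance
proof
  fix f g h :: "'a mfps"
  show "f * g * h = f * (g * h)"
  proof (transfer, rule ext)
    fix f g h :: "'a monomial \<Rightarrow> real" and m :: "'a monomial"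
    have "(\<Sum>(e, c) \<in> splittings m. (\<Sum>(a, b) \<in> splittings e. f a * g b) * h c)
        = (\<Sum>p \<in> splittings m. \<Sum>q \<in> splittings (fst p). f (fst q) * g (snd q) * h (snd p))"
      by (simp add: case_prod_unfold sum_distrib_right)
    also have "\<dots> = (\<Sum>(p, q) \<in> Sigma (splittings m) (\<lambda>p. splittings (fst p)).
                     f (fst q) * g (snd q) * h (snd p))"
      by (rule sum.Sigma) (auto intro: finite_splittings)
    also have "\<dots> = (\<Sum>(p, q) \<in> Sigma (splittings m) (\<lambda>p. splittings (snd p)).
                     f (fst p) * (g (fst q) * h (snd q)))"
      by (rule sum.reindex_bij_witness
          [where i = "\<lambda>((a, e), (b, c)). ((a + b, c), (a, b))"
             and j = "\<lambda>((e, c), (a, b)). ((a, b + c), (b, c))"])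
         (auto simp: add.assoc mult.assoc)
    also have "\<dots> = (\<Sum>p \<in> splittings m. \<Sum>q \<in> splittings (snd p). f (fst p) * (g (fst q) * h (snd q)))"
      by (rule sum.Sigma[symmetric]) (auto intro: finite_splittings)
    also have "\<dots> = (\<Sum>(a, e) \<in> splittings m. f a * (\<Sum>(b, c) \<in> splittings e. g b * h c))"
      by (simp add: case_prod_unfold sum_distrib_left)
    finally show "(\<Sum>(e, c) \<in> splittings m. (\<Sum>(a, b) \<in> splittings e. f a * g b) * h c)
        = (\<Sum>(a, e) \<in> splittings m. f a * (\<Sum>(b, c) \<in> splittings e. g b * h c))" .
  qed
  show "f * g = g * f"
    by (transfer, rule ext,
        rule sum.reindex_bij_witness[where i = "\<lambda>(a, b). (b, a)" and j = "\<lambda>(a, b). (b, a)"])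
       (auto simp: add.commute)
  show "(f + g) * h = f * h + g * h"
    by (transfer, rule ext) (simp add: case_prod_unfold distrib_right sum.distrib)
  show "1 * f = f"
  proof (transfer, rule ext)
    fix f :: "'a monomial \<Rightarrow> real" and m :: "'a monomial"
    have "(\<Sum>(a, b) \<in> splittings m. (if a = 0 then 1 else 0) * f b)
        = (\<Sum>(a, b) \<in> {(0 :: 'a monomial, m)}. (if a = 0 then 1 else 0) * f b)"
      by (rule sum.mono_neutral_right) (auto simp: finite_splittings split: if_splits)
    then show "(\<Sum>(a, b) \<in> splittings m. (if a = 0 then 1 else 0) * f b) = f m"
      by simp
  qed
  show "f + g + h = f + (g + h)" by transfer (simp add: add.assoc)
  show "f + g = g + f" by transfer (simp add: add.commute)
  show "0 + f = f" by transfer simp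
  show "- f + f = 0" by transfer simp
  show "f - g = f + - g" by transfer simp
  show "(0 :: 'a mfps) \<noteq> 1" by transfer (metis zero_neq_one)
qed

end

lemma mfps_lowest_monomial:
  fixes f :: "'n::{finite, linorder} mfps"
  assumes "f \<noteq> 0"
  obtains a where "mfps_coeff f a \<noteq> 0" "\<And>u. mfps_coeff f u \<noteq> 0 \<Longrightarrow> mdeg a \<le> mdeg u"
    "\<And>u. mfps_coeff f u \<noteq> 0 \<Longrightarrow> mdeg u = mdeg a \<Longrightarrow> a \<le> u"
proof -
  obtain u0 where "mfps_coeff f u0 \<noteq> 0"
    using assms by (metis mfps_eqI zero_mfps.rep_eq)
  then have "\<exists>d u. mfps_coeff f u \<noteq> 0 \<and> mdeg u = d" by blast
  define d where "d = (LEAST d. \<exists>u. mfps_coeff f u \<noteq> 0 \<and> mdeg u = d)"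
  have d: "\<exists>u. mfps_coeff f u \<noteq> 0 \<and> mdeg u = d"
    unfolding d_def by (rule LeastI_ex) fact
  have d_le: "d \<le> mdeg u" if "mfps_coeff f u \<noteq> 0" for u
    unfolding d_def using that by (intro Least_le) blast
  define A where "A = {u. mfps_coeff f u \<noteq> 0 \<and> mdeg u = d}"
  have "finite A"
    by (rule finite_subset[OF _ finite_mdeg_le[of d]]) (auto simp: A_def)
  moreover have "A \<noteq> {}" using d by (auto simp: A_def)
  ultimately have "Min A \<in> A" "\<And>u. u \<in> A \<Longrightarrow> Min A \<le> u" by auto
  then show ?thesis using d_le by (intro that[of "Min A"]) (auto simp: A_def)
qed

instance mfps :: ("{finite, linorder}") idom
proof
  fix f g :: "'a mfps"
  assume "f \<noteq> 0" "g \<noteq> 0"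
  from mfps_lowest_monomial[OF this(1)] obtain a where
    a: "mfps_coeff f a \<noteq> 0" "\<And>u. mfps_coeff f u \<noteq> 0 \<Longrightarrow> mdeg a \<le> mdeg u"
    "\<And>u. mfps_coeff f u \<noteq> 0 \<Longrightarrow> mdeg u = mdeg a \<Longrightarrow> a \<le> u" by blast
  from mfps_lowest_monomial[OF \<open>g \<noteq> 0\<close>] obtain b where
    b: "mfps_coeff g b \<noteq> 0" "\<And>u. mfps_coeff g u \<noteq> 0 \<Longrightarrow> mdeg b \<le> mdeg u"
    "\<And>u. mfps_coeff g u \<noteq> 0 \<Longrightarrow> mdeg u = mdeg b \<Longrightarrow> b \<le> u" by blast
  have "u = a \<and> v = b" if "u + v = a + b" "mfps_coeff f u \<noteq> 0" "mfps_coeff g v \<noteq> 0" for u v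
  proof -
    have "mdeg u + mdeg v = mdeg a + mdeg b" using that(1) by (metis mdeg_add)
    with a(2)[OF that(2)] b(2)[OF that(3)] have "mdeg u = mdeg a" "mdeg v = mdeg b" by auto
    with a(3)[OF that(2)] b(3)[OF that(3)] have "a \<le> u" "b \<le> v" by auto
    with that(1) show ?thesis
      by (metis add_le_cancel_left add_le_cancel_right add_left_mono antisym add_left_cancel
          add_right_cancel)
  qed
  then have "(\<Sum>(u, v) \<in> splittings (a + b). mfps_coeff f u * mfps_coeff g v)
      = (\<Sum>(u, v) \<in> {(a, b)}. mfps_coeff f u * mfps_coeff g v)"
    by (intro sum.mono_neutral_right) (auto simp: finite_splittings)
  then have "mfps_coeff (f * g) (a + b) \<noteq> 0"
    using a(1) b(1) by (simp add: times_mfps.rep_eq)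
  then show "f * g \<noteq> 0" by (auto simp: zero_mfps.rep_eq)
qed

definition mfps_of_mpoly :: "'n mpoly \<Rightarrow> 'n mfps" where
  "mfps_of_mpoly P = Abs_mfps (Poly_Mapping.lookup P)"

type_synonym 'n frac = "'n mfps fract"

definition frac_of_mfps :: "'n::{finite, linorder} mfps \<Rightarrow> 'n frac" where
  "frac_of_mfps f = Fract f 1"

definition frac_of_mpoly :: "'n::{finite, linorder} mpoly \<Rightarrow> 'n frac" where
  "frac_of_mpoly P = frac_of_mfps (mfps_of_mpoly P)"


section \<open>Minors and cofactors of \<open>\<ell>\<close>\<close>

definition submat :: "('n::linorder \<Rightarrow> 'n \<Rightarrow> 'a) \<Rightarrow> 'n set \<Rightarrow> 'n set \<Rightarrow> 'a mat" where
  "submat l K I = mat (card K) (card I)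
     (\<lambda>(a, b). l (sorted_list_of_set K ! a) (sorted_list_of_set I ! b))"

definition minor :: "('n::linorder \<Rightarrow> 'n \<Rightarrow> 'a::comm_ring_1) \<Rightarrow> 'n set \<Rightarrow> 'n set \<Rightarrow> 'a" where
  "minor l K I = det (submat l K I)"

definition det_of :: "('n::{finite, linorder} \<Rightarrow> 'n \<Rightarrow> 'a::comm_ring_1) \<Rightarrow> 'a" where
  "det_of l = det (submat l UNIV UNIV)"

text \<open>\<open>card {..<k}\<close> is the (zero-based) position of \<open>k\<close> in the index type.\<close>

definition cofactor_of :: "('n::{finite, linorder} \<Rightarrow> 'n \<Rightarrow> 'a::comm_ring_1) \<Rightarrow> 'n \<Rightarrow> 'n \<Rightarrow> 'a" where
  "cofactor_of l k j = cofactor (submat l UNIV UNIV) (card {..<k}) (card {..<j})"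


section \<open>Polyvector fields with coefficients in the fraction field\<close>

text \<open>\<open>v :: 'n polyvector\<close> represents \<open>\<Sum>\<^sub>S v S \<partial>\<^sub>S\<close>, where \<open>\<partial>\<^sub>S\<close> is the wedge product of the
  \<open>\<partial>\<^sub>s\<close>, \<open>s \<in> S\<close>, in increasing order; all degrees \<open>card S = 0, \<dots>, n\<close> occur.\<close>

type_synonym 'n polyvector = "'n set \<Rightarrow> 'n frac"

definition lincomb :: "'k set \<Rightarrow> ('k \<Rightarrow> 'n::{finite, linorder} frac) \<Rightarrow> ('k \<Rightarrow> 'n polyvector)
    \<Rightarrow> 'n polyvector" where
  "lincomb A c v = (\<lambda>S. \<Sum>k\<in>A. c k * v k S)"

text \<open>\<open>\<partial>\<^sub>A \<and> \<partial>\<^sub>B = (-1)\<^bsup>inv\<^esup> \<partial>\<^bsub>A \<union> B\<^esub>\<close> for disjoint \<open>A\<close>, \<open>B\<close>, where \<open>inv\<close> is the number of inversions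
  between \<open>A\<close> and \<open>B\<close>, and \<open>\<partial>\<^sub>A \<and> \<partial>\<^sub>B = 0\<close> otherwise.\<close>

definition wedge :: "'n::{finite, linorder} polyvector \<Rightarrow> 'n polyvector \<Rightarrow> 'n polyvector" where
  "wedge u v = (\<lambda>S. \<Sum>A\<in>Pow S.
     (-1) ^ card {(a, b). a \<in> A \<and> b \<in> S - A \<and> b < a} * u A * v (S - A))"

definition basis_polyvector :: "'n::{finite, linorder} set \<Rightarrow> 'n polyvector" where
  "basis_polyvector S = (\<lambda>T. if T = S then 1 else 0)"

definition wedge_family :: "('n::{finite, linorder} \<Rightarrow> 'n polyvector) \<Rightarrow> 'n set \<Rightarrow> 'n polyvector" where
  "wedge_family X K = foldr (\<lambda>k. wedge (X k)) (sorted_list_of_set K) (basis_polyvector {})"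

definition partial :: "'n::{finite, linorder} \<Rightarrow> 'n polyvector" where
  "partial j = basis_polyvector {j}"

definition Y_field :: "('n::{finite, linorder} \<Rightarrow> 'n \<Rightarrow> 'n mpoly) \<Rightarrow> 'n \<Rightarrow> 'n polyvector" where
  "Y_field l i = lincomb UNIV (\<lambda>r. frac_of_mpoly (l i r)) partial"


section \<open>Real and potential formal cochains\<close>

definition real_cochains :: "'n::{finite, linorder} polyvector set" where
  "real_cochains =
     {lincomb UNIV (\<lambda>J. frac_of_mfps (f J)) (wedge_family partial) | f. True}"

definition potential_cochains ::
  "('n::{finite, linorder} \<Rightarrow> 'n \<Rightarrow> 'n mpoly) \<Rightarrow> 'n polyvector set" where
  "potential_cochains l =
     {lincomb UNIV (\<lambda>K. frac_of_mfps (f K) / frac_of_mpoly (det_of l)) (wedge_family (Y_field l))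
      | f. True}"

text \<open>\<open>D\<^sup>-\<^sup>1 \<Sum>\<^sub>k L\<^sub>k\<^sub>j Y\<^sub>k\<close>, the expression of \<open>\<partial>\<^sub>j\<close> in terms of the \<open>Y\<^sub>k\<close>.\<close>

definition partial_via_Y ::
  "('n::{finite, linorder} \<Rightarrow> 'n \<Rightarrow> 'n mpoly) \<Rightarrow> 'n \<Rightarrow> 'n polyvector" where
  "partial_via_Y l j =
     lincomb UNIV (\<lambda>k. frac_of_mpoly (cofactor_of l k j) / frac_of_mpoly (det_of l)) (Y_field l)"

text \<open>The map \<open>i\<close>: the coefficient \<open>u J\<close> is kept and each \<open>\<partial>\<^sub>j\<close> in \<open>\<partial>\<^sub>J\<close> is rewritten.\<close>

definition real_to_potential ::
  "('n::{finite, linorder} \<Rightarrow> 'n \<Rightarrow> 'n mpoly) \<Rightarrow> 'n polyvector \<Rightarrow> 'n polyvector" where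
  "real_to_potential l u = lincomb UNIV u (wedge_family (partial_via_Y l))"

definition homogeneous_potential ::
  "('n::{finite, linorder} \<Rightarrow> 'n \<Rightarrow> 'n mpoly) \<Rightarrow> nat \<Rightarrow> ('n set \<Rightarrow> 'n mpoly) \<Rightarrow> 'n polyvector" where
  "homogeneous_potential l p P =
     lincomb {K. card K = p} (\<lambda>K. frac_of_mpoly (P K) / frac_of_mpoly (det_of l))
       (wedge_family (Y_field l))"

end

theory Submission imports Defs begin

text \<open>
  By the cofactor formula \<open>D\<^sup>-\<^sup>1 \<Sum>\<^sub>k L\<^sub>k\<^sub>j Y\<^sub>k = \<partial>\<^sub>j\<close>, the map \<open>i\<close> is the identity of the space of
  polyvector fields, so everything is about membership in the two subspaces. The coefficient of
  \<open>Y\<^sub>K\<close> on \<open>\<partial>\<^sub>I\<close> is the minor of \<open>\<ell>\<close> with rows \<open>K\<close> and columns \<open>I\<close>, which reduces (ii) to divisibility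
  by \<open>D\<close> among power series; for homogeneous polynomials this is divisibility among polynomials.
  That \<open>\<R> \<subseteq> \<P>\<close> needs only a single factor \<open>D\<^sup>-\<^sup>1\<close> in every degree is the Laplace
  expansion along several columns: the wedge product of the columns \<open>I\<close> with the columns complementary to \<open>J\<close> is \<open>\<plusminus> D\<close> times the
  volume element if \<open>I = J\<close>, and has a repeated factor if \<open>I\<close> is another set of the same size.
  Finally, \<open>D\<^sup>-\<^sup>1\<close> is potential but not real, because \<open>D\<close> has no constant term.
\<close>


section \<open>Polynomials and power series inside the fraction field\<close>

lemma mfps_coeff_of_mpoly [simp]: "mfps_coeff (mfps_of_mpoly P) = Poly_Mapping.lookup P"
  by (simp add: mfps_of_mpoly_def Abs_mfps_inverse)

text \<open>Brings the polynomial product into the finite form that defines the product of power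
  series, so the two products can be compared coefficientwise.\<close>

lemma lookup_times_splittings:
  fixes P Q :: "'n::finite mpoly"
  shows "Poly_Mapping.lookup (P * Q) m
    = (\<Sum>(a, b)\<in>splittings m. Poly_Mapping.lookup P a * Poly_Mapping.lookup Q b)"
proof -
  let ?h = "\<lambda>(a, b). Poly_Mapping.lookup P a * Poly_Mapping.lookup Q b when m = a + b"
  have "Poly_Mapping.lookup (P * Q) m = Sum_any ?h"
    by (simp add: times_poly_mapping.rep_eq prod_fun_unfold_prod)
  also have "\<dots> = sum ?h (splittings m)"
    by (rule Sum_any.expand_superset[OF finite_splittings]) (auto simp: when_def split: if_splits)
  also have "\<dots> = (\<Sum>(a, b)\<in>splittings m. Poly_Mapping.lookup P a * Poly_Mapping.lookup Q b)"
    by (rule sum.cong) auto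
  finally show ?thesis .
qed

interpretation frac_of_mfps: inj_comm_ring_hom "frac_of_mfps :: 'n::{finite, linorder} mfps \<Rightarrow> 'n frac"
  by unfold_locales
     (simp_all add: frac_of_mfps_def Zero_fract_def One_fract_def eq_fract)

interpretation frac_of_mpoly: inj_comm_ring_hom "frac_of_mpoly :: 'n::{finite, linorder} mpoly \<Rightarrow> 'n frac"
proof -
  have "mfps_of_mpoly (P + Q) = mfps_of_mpoly P + mfps_of_mpoly Q" for P Q :: "'n mpoly"
    by (rule mfps_eqI) (simp add: plus_mfps.rep_eq lookup_add)
  moreover have "mfps_of_mpoly (P * Q) = mfps_of_mpoly P * mfps_of_mpoly Q" for P Q :: "'n mpoly"
    by (rule mfps_eqI) (simp add: times_mfps.rep_eq lookup_times_splittings)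
  moreover have "mfps_of_mpoly (0 :: 'n mpoly) = 0"
    by (rule mfps_eqI) (simp add: zero_mfps.rep_eq)
  moreover have "mfps_of_mpoly (1 :: 'n mpoly) = 1"
    by (rule mfps_eqI) (simp add: one_mfps.rep_eq lookup_one when_def)
  moreover have "P = Q" if "mfps_of_mpoly P = mfps_of_mpoly Q" for P Q :: "'n mpoly"
    using that by (metis mfps_coeff_of_mpoly poly_mapping_eqI)
  ultimately show "inj_comm_ring_hom (frac_of_mpoly :: 'n mpoly \<Rightarrow> 'n frac)"
    by unfold_locales
       (auto simp: frac_of_mpoly_def frac_of_mfps.hom_add frac_of_mfps.hom_mult)
qed


section \<open>Homogeneous polynomials\<close>

lemma homogeneous_iff: "homogeneous r P \<longleftrightarrow> (\<forall>m. Poly_Mapping.lookup P m \<noteq> 0 \<longrightarrow> mdeg m = r)"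
  by (auto simp: homogeneous_def in_keys_iff)

lemma homogeneous_0 [simp]: "homogeneous r 0"
  by (simp add: homogeneous_def)

lemma homogeneous_1 [simp]: "homogeneous 0 1"
  by (simp add: homogeneous_def mdeg_def)

lemma homogeneous_uminus [simp]: "homogeneous r (- P) \<longleftrightarrow> homogeneous r P"
  by (simp add: homogeneous_iff)

lemma homogeneous_add: "homogeneous r P \<Longrightarrow> homogeneous r Q \<Longrightarrow> homogeneous r (P + Q)"
  unfolding homogeneous_iff lookup_add by (metis add.right_neutral)

lemma homogeneous_sum: "(\<And>x. x \<in> A \<Longrightarrow> homogeneous r (f x)) \<Longrightarrow> homogeneous r (sum f A)"
  by (induction A rule: infinite_finite_induct) (auto intro: homogeneous_add)

lemma homogeneous_mult:
  assumes "homogeneous r P" "homogeneous s Q"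
  shows "homogeneous (r + s) (P * Q)"
  unfolding homogeneous_iff
proof (intro allI impI)
  fix m assume "Poly_Mapping.lookup (P * Q) m \<noteq> 0"
  then obtain a b where "a + b = m" "Poly_Mapping.lookup P a \<noteq> 0" "Poly_Mapping.lookup Q b \<noteq> 0"
    unfolding lookup_times_splittings by (elim sum.not_neutral_contains_not_neutral) auto
  with assms show "mdeg m = r + s" by (auto simp: homogeneous_iff mdeg_add)
qed

lemma homogeneous_prod:
  assumes "\<And>x. x \<in> A \<Longrightarrow> homogeneous 1 (f x)"
  shows "homogeneous (card A) (prod f A)"
  using assms
proof (induction A rule: infinite_finite_induct)
  case (insert x A)
  then show ?case using homogeneous_mult[of 1 "f x" "card A" "prod f A"] by simp
qed auto

text \<open>In the Leibniz formula every summand is a signed product of \<open>card K\<close> linear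
  forms. If \<open>K\<close> and \<open>I\<close> differ in size, \<open>det\<close> is 0 by
  convention, and 0 is homogeneous of every degree.\<close>

lemma homogeneous_minor:
  fixes l :: "'n::{finite, linorder} \<Rightarrow> 'n \<Rightarrow> 'n mpoly"
  assumes "\<forall>i r. homogeneous 1 (l i r)"
  shows "homogeneous (card K) (minor l K I)"
proof (cases "card K = card I")
  case True
  have "homogeneous (card K) (\<Prod>i = 0..<card K. submat l K I $$ (i, p i))"
    if "p permutes {0..<card K}" for p
  proof -
    have "homogeneous 1 (submat l K I $$ (i, p i))" if "i \<in> {0..<card K}" for i
      using assms that True permutes_in_image[OF \<open>p permutes _\<close>, of i] by (simp add: submat_def)
    then have "homogeneous (card {0..<card K}) (\<Prod>i = 0..<card K. submat l K I $$ (i, p i))"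
      by (rule homogeneous_prod)
    then show ?thesis by simp
  qed
  then show ?thesis
    unfolding minor_def det_def
    by (auto simp: submat_def True sign_def intro!: homogeneous_sum)
qed (simp add: minor_def det_def submat_def)

text \<open>Only the homogeneous part of the quotient of the right degree contributes to the product, and
  it is a polynomial.\<close>

lemma dvd_of_homogeneous_mfps_quotient:
  fixes D Q :: "'n::{finite, linorder} mpoly"
  assumes D: "homogeneous d D" and Q: "homogeneous q Q"
    and eq: "mfps_of_mpoly D * g = mfps_of_mpoly Q"
  shows "D dvd Q"
proof -
  \<comment> \<open>The degree condition is additive on purpose: for \<open>q < d\<close> no
    monomial satisfies it and \<open>h\<close> is zero, whereas \<open>q - d\<close> would be
    truncated to 0.\<close>
  define h where "h m = (if d + mdeg m = q then mfps_coeff g m else 0)" for m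
  have fin: "finite {m. h m \<noteq> 0}"
    by (rule finite_subset[OF _ finite_mdeg_le[of q]]) (auto simp: h_def split: if_splits)
  have lookup_G: "Poly_Mapping.lookup (Abs_poly_mapping h) = h"
    by (simp add: lookup_Abs_poly_mapping fin)
  have "Poly_Mapping.lookup (D * Abs_poly_mapping h) m = Poly_Mapping.lookup Q m" for m
  proof (cases "mdeg m = q")
    case True
    have "Poly_Mapping.lookup D a * h b = Poly_Mapping.lookup D a * mfps_coeff g b"
      if "a + b = m" for a b
      using D True that by (auto simp: homogeneous_iff h_def mdeg_add)
    then have "Poly_Mapping.lookup (D * Abs_poly_mapping h) m
        = mfps_coeff (mfps_of_mpoly D * g) m"
      by (auto simp: lookup_times_splittings times_mfps.rep_eq lookup_G intro!: sum.cong)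
    then show ?thesis by (simp add: eq)
  next
    case False
    have "Poly_Mapping.lookup D a * h b = 0" if "a + b = m" for a b
      using D False that by (auto simp: homogeneous_iff h_def mdeg_add)
    then have "Poly_Mapping.lookup (D * Abs_poly_mapping h) m = 0"
      by (auto simp: lookup_times_splittings lookup_G intro!: sum.neutral)
    then show ?thesis using Q False by (auto simp: homogeneous_iff)
  qed
  then show ?thesis by (metis dvd_triv_left poly_mapping_eqI)
qed

text \<open>Clearing the denominator turns a quotient lying in the power series into an identity
  \<open>D * g = Q\<close> there, to which the homogeneous quotient argument applies.\<close>

lemma frac_of_mpoly_divide_in_mfps_iff:
  assumes "homogeneous d D" "homogeneous q Q" and "D \<noteq> 0"
  shows "frac_of_mpoly Q / frac_of_mpoly D \<in> range frac_of_mfps \<longleftrightarrow> D dvd Q"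
proof
  assume "frac_of_mpoly Q / frac_of_mpoly D \<in> range frac_of_mfps"
  then obtain g where "frac_of_mpoly Q / frac_of_mpoly D = frac_of_mfps g" by blast
  then have "frac_of_mfps (mfps_of_mpoly D * g) = frac_of_mfps (mfps_of_mpoly Q)"
    using assms(3) by (simp add: frac_of_mfps.hom_mult field_simps flip: frac_of_mpoly_def)
  then show "D dvd Q"
    using dvd_of_homogeneous_mfps_quotient[OF assms(1,2)] by simp
next
  assume "D dvd Q"
  then obtain R where "Q = D * R" by blast
  then have "frac_of_mpoly Q / frac_of_mpoly D = frac_of_mfps (mfps_of_mpoly R)"
    using assms(3) by (simp add: frac_of_mpoly.hom_mult flip: frac_of_mpoly_def)
  then show "frac_of_mpoly Q / frac_of_mpoly D \<in> range frac_of_mfps" by blast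
qed


section \<open>Minors\<close>

lemma minor_frac_of_mpoly:
  "minor (\<lambda>i j. frac_of_mpoly (l i j)) K I = frac_of_mpoly (minor l K I)"
proof -
  have "submat (\<lambda>i j. frac_of_mpoly (l i j)) K I = map_mat frac_of_mpoly (submat l K I)"
    by (rule eq_matI) (auto simp: submat_def)
  then show ?thesis by (simp add: minor_def)
qed

text \<open>By convention \<open>det\<close> vanishes on non-square matrices. Sums over index sets
  can thus run over all subsets, without a restriction on their size.\<close>

lemma minor_card_neq: "card K \<noteq> card I \<Longrightarrow> minor l K I = 0"
  by (simp add: minor_def det_def submat_def)

lemma minor_empty: "minor l {} {} = 1"
  by (simp add: minor_def submat_def)

lemma minor_transpose:
  assumes "card K = card I"
  shows "minor (\<lambda>i j. l j i) I K = minor l K I"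
proof -
  have "submat (\<lambda>i j. l j i) I K = transpose_mat (submat l K I)"
    by (rule eq_matI) (auto simp: submat_def)
  moreover have "submat l K I \<in> carrier_mat (card K) (card K)"
    using assms by (simp add: submat_def)
  ultimately show ?thesis unfolding minor_def by (metis det_transpose)
qed

section \<open>Increasing enumeration of a finite index set\<close>

lemma bij_betw_sorted_list_of_set:
  "bij_betw (\<lambda>a. sorted_list_of_set I ! a) {..<card I} I" if "finite I"
  by (rule bij_betw_nth) (use that in auto)

text \<open>The enumeration is strictly increasing. This translates the column position in a
  cofactor sign into the inversion count in the sign of \<open>wedge\<close>.\<close>

lemma card_less_sorted_list_of_set_nth:
  fixes I :: "'a::linorder set"
  assumes "finite I" "a < card I"
  shows "card {b \<in> I. b < sorted_list_of_set I ! a} = a"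
proof -
  let ?xs = "sorted_list_of_set I"
  have sm: "strict_mono_on {..<card I} (\<lambda>a. ?xs ! a)"
    using sorted_wrt_nth_less[OF strict_sorted_list_of_set[of I]]
    by (auto simp: strict_mono_on_def)
  have "{b \<in> I. b < ?xs ! a} = (\<lambda>a. ?xs ! a) ` {..<a}" (is "?L = ?R")
  proof
    show "?L \<subseteq> ?R"
    proof
      fix b assume b: "b \<in> ?L"
      then obtain c where c: "c < card I" "b = ?xs ! c"
        using bij_betw_sorted_list_of_set[OF assms(1)] by (auto simp: bij_betw_def)
      with b have "c < a" using strict_mono_on_less[OF sm, of c a] assms by auto
      with c show "b \<in> ?R" by blast
    qed
    show "?R \<subseteq> ?L"
    proof
      fix b assume "b \<in> ?R"
      then obtain c where c: "c < a" "b = ?xs ! c" by blast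
      then have "b \<in> I" using assms by (metis length_sorted_list_of_set nth_mem order.strict_trans set_sorted_list_of_set)
      moreover have "b < ?xs ! a" using c assms sm by (auto simp: strict_mono_on_def)
      ultimately show "b \<in> ?L" by blast
    qed
  qed
  moreover have "inj_on (\<lambda>a. ?xs ! a) {..<a}"
    using assms by (auto simp: inj_on_def nth_eq_iff_index_eq)
  ultimately show ?thesis by (simp add: card_image)
qed

text \<open>Positions from \<open>a\<close> on shift by one, exactly as column indices do under
  \<open>mat_delete\<close>.\<close>

lemma sorted_list_of_set_remove_nth:
  fixes I :: "'a::linorder set"
  assumes "finite I" "a < card I" "b < card I - 1"
  shows "sorted_list_of_set (I - {sorted_list_of_set I ! a}) ! b
    = sorted_list_of_set I ! (if b < a then b else Suc b)"
proof -
  let ?xs = "sorted_list_of_set I"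
  let ?ys = "take a ?xs @ drop (Suc a) ?xs"
  have xs: "?xs = take a ?xs @ ?xs ! a # drop (Suc a) ?xs"
    using assms by (simp add: id_take_nth_drop)
  have d: "distinct ?xs" by simp
  \<comment> \<open>\<open>remove1\<close> deletes the first occurrence, so the entry must not occur
    before position \<open>a\<close>.\<close>
  then have "?xs ! a \<notin> set (take a ?xs)"
    by (subst (asm) xs) auto
  then have "remove1 (?xs ! a) ?xs = ?ys"
    by (subst (2) xs) (simp add: remove1_append)
  then have "sorted_list_of_set (I - {?xs ! a}) = ?ys"
    using assms(1) by (simp add: sorted_list_of_set.sorted_key_list_of_set_remove)
  then show ?thesis using assms by (auto simp: nth_append min_def)
qed

lemma sorted_list_of_set_insert_less:
  assumes "finite K" "\<forall>s\<in>K. k < s"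
  shows "sorted_list_of_set (insert k K) = k # sorted_list_of_set K"
proof -
  have "k \<notin> K" using assms(2) by auto
  then show ?thesis using assms by (simp add: insort_is_Cons less_imp_le)
qed

text \<open>As \<open>k\<close> precedes all of \<open>K\<close>, it labels the top row, and this is
  Laplace expansion along that row. The sign is written as an inversion count to match
  \<open>wedge\<close> with a vector field.\<close>

lemma minor_insert_less:
  fixes l :: "'n::{finite, linorder} \<Rightarrow> 'n \<Rightarrow> 'a::comm_ring_1"
  assumes "\<forall>s\<in>K. k < s"
  shows "minor l (insert k K) I
    = (\<Sum>s\<in>I. (-1) ^ card {b \<in> I. b < s} * l k s * minor l K (I - {s}))"
\<comment> \<open>Unless the enlarged matrix is square, none of the minors on either side is square
  and both sides vanish.\<close>
proof (cases "card I = Suc (card K)")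
  case False
  have "k \<notin> K" using assms by auto
  then have "minor l (insert k K) I = 0" using False by (simp add: minor_card_neq)
  moreover have "minor l K (I - {s}) = 0" if "s \<in> I" for s
    using that False by (intro minor_card_neq) (metis card.remove finite)
  ultimately show ?thesis by simp
next
  case True
  let ?xs = "sorted_list_of_set I"
  have k: "k \<notin> K" using assms by auto
  have K: "sorted_list_of_set (insert k K) = k # sorted_list_of_set K"
    by (rule sorted_list_of_set_insert_less) (use assms in auto)
  have M: "submat l (insert k K) I \<in> carrier_mat (card I) (card I)"
    using True k by (simp add: submat_def)
  have entry: "submat l (insert k K) I $$ (0, j) = l k (?xs ! j)" if "j < card I" for j
    using that k by (simp add: submat_def K del: sorted_list_of_set.sorted_key_list_of_set_insert_remove)
  have minor_delete: "det (mat_delete (submat l (insert k K) I) 0 j) = minor l K (I - {?xs ! j})"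
    if j: "j < card I" for j
  proof -
    have "?xs ! j \<in> I" using j by (metis finite length_sorted_list_of_set nth_mem set_sorted_list_of_set)
    then have c: "card (I - {?xs ! j}) = card I - 1" by simp
    have "mat_delete (submat l (insert k K) I) 0 j = submat l K (I - {?xs ! j})"
      using j k c True
      by (intro eq_matI)
         (simp_all add: submat_def mat_delete_def K sorted_list_of_set_remove_nth
           del: sorted_list_of_set.sorted_key_list_of_set_insert_remove)
    then show ?thesis by (simp add: minor_def)
  qed
  have "minor l (insert k K) I
      = (\<Sum>j<card I. submat l (insert k K) I $$ (0, j) * cofactor (submat l (insert k K) I) 0 j)"
    unfolding minor_def using True by (intro laplace_expansion_row[OF M]) simp
  also have "\<dots> = (\<Sum>j<card I. (-1) ^ card {b \<in> I. b < ?xs ! j} * l k (?xs ! j) * minor l K (I - {?xs ! j}))"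
    by (rule sum.cong)
       (auto simp: cofactor_def entry minor_delete card_less_sorted_list_of_set_nth mult_ac)
  also have "\<dots> = (\<Sum>s\<in>I. (-1) ^ card {b \<in> I. b < s} * l k s * minor l K (I - {s}))"
    by (rule sum.reindex_bij_betw) (rule bij_betw_sorted_list_of_set, simp)
  finally show ?thesis .
qed

section \<open>Full determinant and cofactors\<close>

lemma det_of_eq_minor: "det_of l = minor l UNIV UNIV"
  by (simp add: det_of_def minor_def)

text \<open>This is the identity \<open>adj_mat A * A = det A\<close> times the unit matrix, read at
  one entry and carried from numerical indices to the index type.\<close>

lemma sum_cofactor_mult:
  fixes l :: "'n::{finite, linorder} \<Rightarrow> 'n \<Rightarrow> 'a::comm_ring_1"
  shows "(\<Sum>k\<in>UNIV. cofactor_of l k j * l k r) = (if j = r then det_of l else 0)"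
proof -
  let ?n = "CARD('n)" and ?xs = "sorted_list_of_set (UNIV :: 'n set)"
  let ?A = "submat l UNIV UNIV"
  have A: "?A \<in> carrier_mat ?n ?n" by (simp add: submat_def)
  note bij = bij_betw_sorted_list_of_set[OF finite[of "UNIV :: 'n set"]]
  have pos: "card {..<?xs ! a} = a" if "a < ?n" for a
    using card_less_sorted_list_of_set_nth[OF finite that] by (simp only: lessThan_def UNIV_I simp_thms)
  have "\<exists>a<?n. i = ?xs ! a" for i
    using bij_betw_imp_surj_on[OF bij] by (auto simp: set_eq_iff image_iff)
  then obtain a b where a: "a < ?n" "j = ?xs ! a" and b: "b < ?n" "r = ?xs ! b" by meson
  have "(\<Sum>k\<in>UNIV. cofactor_of l k j * l k r)
      = (\<Sum>c<?n. cofactor_of l (?xs ! c) j * l (?xs ! c) r)"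
    by (rule sum.reindex_bij_betw[symmetric]) (rule bij)
  also have "\<dots> = (\<Sum>c = 0..<?n. adj_mat ?A $$ (a, c) * ?A $$ (c, b))"
    using a b by (intro sum.cong) (auto simp: cofactor_of_def adj_mat_def pos submat_def)
  also have "\<dots> = (adj_mat ?A * ?A) $$ (a, b)"
    using a b A adj_mat(1)[OF A] by (simp add: scalar_prod_def)
  also have "\<dots> = (if a = b then det_of l else 0)"
    using a b by (simp add: adj_mat(3)[OF A] det_of_def)
  also have "a = b \<longleftrightarrow> j = r"
    using a b by (auto simp: nth_eq_iff_index_eq)
  finally show ?thesis .
qed


section \<open>The exterior algebra\<close>

text \<open>The value ring is left open because the same sign is needed both among power series and
  among fractions.\<close>

definition inv_sign :: "'n::{finite, linorder} set \<Rightarrow> 'n set \<Rightarrow> 'a::comm_ring_1" where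
  "inv_sign A B = (-1) ^ card {(a, b). a \<in> A \<and> b \<in> B \<and> b < a}"

lemma wedge_eq: "wedge u v S = (\<Sum>A\<in>Pow S. inv_sign A (S - A) * u A * v (S - A))"
  by (simp add: wedge_def inv_sign_def)

text \<open>Inversions are counted pair by pair, so the count is additive over a disjoint union in
  either argument.\<close>

lemma inv_sign_Un_left:
  assumes "A \<inter> B = {}"
  shows "inv_sign (A \<union> B) C = inv_sign A C * inv_sign B C"
proof -
  have "{(a, b). a \<in> A \<union> B \<and> b \<in> C \<and> b < a}
      = {(a, b). a \<in> A \<and> b \<in> C \<and> b < a} \<union> {(a, b). a \<in> B \<and> b \<in> C \<and> b < a}" by auto
  then show ?thesis
    unfolding inv_sign_def power_add[symmetric]
    by (subst card_Un_disjoint[symmetric]) (use assms in auto)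
qed

lemma inv_sign_Un_right:
  assumes "B \<inter> C = {}"
  shows "inv_sign A (B \<union> C) = inv_sign A B * inv_sign A C"
proof -
  have "{(a, b). a \<in> A \<and> b \<in> B \<union> C \<and> b < a}
      = {(a, b). a \<in> A \<and> b \<in> B \<and> b < a} \<union> {(a, b). a \<in> A \<and> b \<in> C \<and> b < a}" by auto
  then show ?thesis
    unfolding inv_sign_def power_add[symmetric]
    by (subst card_Un_disjoint[symmetric]) (use assms in auto)
qed

lemma inv_sign_singleton_left: "inv_sign {s} B = (-1) ^ card {b \<in> B. b < s}"
proof -
  have "{(a, b). a \<in> {s} \<and> b \<in> B \<and> b < a} = Pair s ` {b \<in> B. b < s}" by auto
  then show ?thesis by (simp add: inv_sign_def card_image inj_on_def)
qed

text \<open>The inequality is weak because \<open>B\<close> may contain \<open>s\<close> itself,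
  which is no inversion.\<close>

lemma inv_sign_lower_bound:
  assumes "\<forall>b\<in>B. s \<le> b"
  shows "inv_sign {s} B = 1"
proof -
  have "{b \<in> B. b < s} = {}" using assms by auto
  then show ?thesis by (simp only: inv_sign_singleton_left card.empty power_0)
qed

lemma inv_sign_empty [simp]: "inv_sign {} B = 1" "inv_sign A {} = 1"
  by (simp_all add: inv_sign_def)

lemma inv_sign_square [simp]: "inv_sign A B * inv_sign A B = 1"
  by (simp add: inv_sign_def flip: power_add mult_2)

text \<open>Both sides sum over the ordered partitions of \<open>S\<close> into three blocks, and
  both signs count the inversions between the three pairs of blocks.\<close>

lemma wedge_assoc: "wedge (wedge u v) w = wedge u (wedge v w)"
proof
  fix S :: "'a set"
  have "wedge (wedge u v) w S
      = (\<Sum>(E, A)\<in>Sigma (Pow S) Pow. inv_sign E (S - E) * (inv_sign A (E - A) * u A * v (E - A)) * w (S - E))"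
    by (simp add: wedge_eq sum_distrib_left sum_distrib_right sum.Sigma)
  also have "\<dots> = (\<Sum>(A, B)\<in>Sigma (Pow S) (\<lambda>A. Pow (S - A)).
      inv_sign A (S - A) * u A * (inv_sign B (S - A - B) * v B * w (S - A - B)))"
  proof (rule sum.reindex_bij_witness[where i = "\<lambda>(A, B). (A \<union> B, A)" and j = "\<lambda>(E, A). (A, E - A)"],
      goal_cases)
    \<comment> \<open>Equality of summands, with blocks \<open>A\<close>, \<open>E - A\<close> and
      \<open>S - E\<close>; the remaining obligations are set algebra.\<close>
    case (5 x)
    obtain E A where x: "x = (E, A)" "A \<subseteq> E" "E \<subseteq> S" using 5 by auto
    then have S: "S - A - (E - A) = S - E" "S - A = (E - A) \<union> (S - E)" by auto
    have "inv_sign (A \<union> (E - A)) (S - E) = (inv_sign A (S - E) * inv_sign (E - A) (S - E) :: 'a frac)"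
      by (rule inv_sign_Un_left) auto
    then have "inv_sign E (S - E) = (inv_sign A (S - E) * inv_sign (E - A) (S - E) :: 'a frac)"
      using x by (simp add: Un_absorb1)
    moreover have "inv_sign A (S - A) = (inv_sign A (E - A) * inv_sign A (S - E) :: 'a frac)"
      unfolding S(2) by (rule inv_sign_Un_right) auto
    ultimately show ?case using x S(1) by (simp add: mult_ac)
  qed auto
  also have "\<dots> = wedge u (wedge v w) S"
    by (simp add: wedge_eq sum_distrib_left sum.Sigma)
  finally show "wedge (wedge u v) w S = wedge u (wedge v w) S" .
qed

lemma wedge_uminus_left: "wedge (\<lambda>S. - u S) v = (\<lambda>S. - wedge u v S)"
  by (simp add: wedge_def sum_negf)

lemma wedge_scale_right: "wedge u (\<lambda>S. c * v S) = (\<lambda>S. c * wedge u v S)"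
  by (simp add: wedge_def sum_distrib_left mult_ac)

lemma wedge_0_right: "wedge u (\<lambda>S. 0) = (\<lambda>S. 0)"
  by (simp add: wedge_def)

lemma wedge_0_left: "wedge (\<lambda>S. 0) v = (\<lambda>S. 0)"
  by (simp add: wedge_def)

lemma wedge_unit_left: "wedge (basis_polyvector {}) v = v"
proof
  fix S
  have "wedge (basis_polyvector {}) v S
      = (\<Sum>A\<in>{{}}. inv_sign A (S - A) * basis_polyvector {} A * v (S - A))"
    unfolding wedge_eq by (rule sum.mono_neutral_right) (auto simp: basis_polyvector_def)
  then show "wedge (basis_polyvector {}) v S = v S" by (simp add: basis_polyvector_def)
qed

section \<open>Products with vector fields\<close>

definition vector_field :: "('n::{finite, linorder} \<Rightarrow> 'n frac) \<Rightarrow> 'n polyvector" where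
  "vector_field c = lincomb UNIV c partial"

lemma vector_field_singleton [simp]: "vector_field c {r} = c r"
proof -
  have "(\<Sum>k\<in>UNIV. c k * (if {r} = {k} then 1 else 0)) = (\<Sum>k\<in>UNIV. if r = k then c k else 0)"
    by (rule sum.cong) auto
  then show ?thesis by (simp add: vector_field_def lincomb_def partial_def basis_polyvector_def)
qed

lemma vector_field_eq_0: "(\<And>s. S \<noteq> {s}) \<Longrightarrow> vector_field c S = 0"
  by (simp add: vector_field_def lincomb_def partial_def basis_polyvector_def)

text \<open>Only singletons \<open>A\<close> contribute to the product, which gives it the shape of
  a row expansion. Writing \<open>S\<close> for \<open>S - {s}\<close> in the sign is harmless,
  since \<open>s\<close> is not below itself.\<close>

lemma wedge_vector_field:
  "wedge (vector_field c) v S = (\<Sum>s\<in>S. inv_sign {s} S * c s * v (S - {s}))"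
proof -
  have "wedge (vector_field c) v S
      = (\<Sum>A\<in>(\<lambda>s. {s}) ` S. inv_sign A (S - A) * vector_field c A * v (S - A))"
    unfolding wedge_eq
  proof (rule sum.mono_neutral_right)
    show "\<forall>A\<in>Pow S - (\<lambda>s. {s}) ` S. inv_sign A (S - A) * vector_field c A * v (S - A) = 0"
    proof
      fix A assume "A \<in> Pow S - (\<lambda>s. {s}) ` S"
      then have "vector_field c A = 0" by (intro vector_field_eq_0) auto
      then show "inv_sign A (S - A) * vector_field c A * v (S - A) = 0" by simp
    qed
  qed auto
  also have "\<dots> = (\<Sum>s\<in>S. inv_sign {s} (S - {s}) * c s * v (S - {s}))"
    by (simp add: sum.reindex inj_on_def)
  also have "\<dots> = (\<Sum>s\<in>S. inv_sign {s} S * c s * v (S - {s}))"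
  proof (rule sum.cong)
    fix s
    have "{b \<in> S - {s}. b < s} = {b \<in> S. b < s}" by auto
    then show "inv_sign {s} (S - {s}) * c s * v (S - {s})
        = inv_sign {s} S * c s * v (S - {s})"
      by (simp add: inv_sign_singleton_left)
  qed simp
  finally show ?thesis .
qed

text \<open>The product is a 2 by 2 determinant on pairs and zero elsewhere; anticommutation and
  vanishing squares are read off from this.\<close>

lemma wedge_vector_field_vector_field:
  "s < t \<Longrightarrow> wedge (vector_field c) (vector_field d) {s, t} = c s * d t - c t * d s"
  "(\<And>s t. s < t \<Longrightarrow> S \<noteq> {s, t}) \<Longrightarrow> wedge (vector_field c) (vector_field d) S = 0"
proof -
  assume st: "s < t"
  then have "{s, t} - {s} = {t}" "{s, t} - {t} = {s}" by auto
  moreover have "inv_sign {s} {s, t} = (1 :: 'a frac)"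
    using st by (intro inv_sign_lower_bound) auto
  moreover have "{b \<in> {s, t}. b < t} = {s}" using st by auto
  then have "inv_sign {t} {s, t} = (- 1 :: 'a frac)"
    unfolding inv_sign_singleton_left by simp
  ultimately show "wedge (vector_field c) (vector_field d) {s, t} = c s * d t - c t * d s"
    using st by (simp add: wedge_vector_field)
next
  assume S: "\<And>s t. s < t \<Longrightarrow> S \<noteq> {s, t}"
  have "S - {s} \<noteq> {t}" if "s \<in> S" for s t
  proof
    assume "S - {s} = {t}"
    with that have "S = {s, t}" "S = {t, s}" "s \<noteq> t" by auto
    with S show False by (metis linorder_neqE)
  qed
  then have "vector_field d (S - {s}) = 0" if "s \<in> S" for s
    using that by (intro vector_field_eq_0) auto
  then show "wedge (vector_field c) (vector_field d) S = 0" by (simp add: wedge_vector_field)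
qed

lemma wedge_vector_field_anticommute:
  "wedge (vector_field c) (vector_field d) S = - wedge (vector_field d) (vector_field c) S"
proof (cases "\<exists>s t. s < t \<and> S = {s, t}")
  case True
  then show ?thesis by (auto simp: wedge_vector_field_vector_field(1))
next
  case False
  then have "wedge (vector_field c) (vector_field d) S = 0" for c d
    by (intro wedge_vector_field_vector_field(2)) auto
  then show ?thesis by simp
qed

lemma wedge_vector_field_swap:
  "wedge (vector_field c) (wedge (vector_field d) w) S = - wedge (vector_field d) (wedge (vector_field c) w) S"
proof -
  have "wedge (vector_field c) (vector_field d) = (\<lambda>S. - wedge (vector_field d) (vector_field c) S)"
    by (rule ext) (rule wedge_vector_field_anticommute)
  then have "wedge (wedge (vector_field c) (vector_field d)) w S = - wedge (wedge (vector_field d) (vector_field c)) w S"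
    by (simp add: wedge_uminus_left)
  then show ?thesis by (simp add: wedge_assoc)
qed

lemma wedge_vector_field_self: "wedge (vector_field c) (wedge (vector_field c) w) = (\<lambda>S. 0)"
proof -
  have "wedge (vector_field c) (vector_field c) S = 0" for S
    by (cases "\<exists>s t. s < t \<and> S = {s, t}")
       (auto simp: wedge_vector_field_vector_field(1) intro: wedge_vector_field_vector_field(2))
  then have "wedge (vector_field c) (vector_field c) = (\<lambda>S. 0)" by (rule ext)
  then show ?thesis by (simp add: wedge_0_left flip: wedge_assoc)
qed

section \<open>Ordered products of a family of vector fields\<close>

lemma wedge_family_empty: "wedge_family X {} = basis_polyvector {}"
  by (simp add: wedge_family_def)

lemma wedge_family_insert_less:
  assumes "\<forall>s\<in>K. k < s"
  shows "wedge_family X (insert k K) = wedge (X k) (wedge_family X K)"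
  unfolding wedge_family_def sorted_list_of_set_insert_less[OF finite assms] by simp

text \<open>Adding a new least element prepends one factor to the ordered product.\<close>

lemma finite_set_insert_less_induct [case_names empty insert_less]:
  fixes A :: "'n::{finite, linorder} set"
  assumes "P {}" "\<And>k K. \<forall>s\<in>K. k < s \<Longrightarrow> P K \<Longrightarrow> P (insert k K)"
  shows "P A"
  using finite[of A] by (induction rule: finite_linorder_min_induct) (use assms in auto)

text \<open>Splitting off the factor of least index is Laplace expansion along the first row.\<close>

lemma wedge_family_vector_field:
  "wedge_family (\<lambda>i. vector_field (l i)) K I = minor l K I"
proof (induction K arbitrary: I rule: finite_set_insert_less_induct)
  case empty
  then show ?case
    by (cases "I = {}")
       (auto simp: wedge_family_empty basis_polyvector_def minor_empty minor_card_neq)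
next
  case (insert_less k K)
  then show ?case
    by (simp add: wedge_family_insert_less wedge_vector_field minor_insert_less
        inv_sign_singleton_left)
qed

text \<open>The factor \<open>X k\<close> moves right to its sorted place, with one sign for each
  smaller index passed; meeting its own copy, it gives zero.\<close>

lemma wedge_vector_wedge_family:
  fixes c :: "'n::{finite, linorder} \<Rightarrow> 'n \<Rightarrow> 'n frac"
  defines "X \<equiv> \<lambda>i. vector_field (c i)"
  shows "wedge (X k) (wedge_family X S)
    = (\<lambda>T. if k \<in> S then 0 else inv_sign {k} S * wedge_family X (insert k S) T)"
proof (induction S rule: finite_set_insert_less_induct)
  case empty
  then show ?case by (simp add: wedge_family_insert_less[of "{}"])
next
  case (insert_less m S)
  consider "k < m" | "k = m" | "m < k" by (metis linorder_neqE)
  then show ?case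
  proof cases
    case 1
    then have less: "\<forall>s\<in>insert m S. k < s" using insert_less(1) by auto
    then have "inv_sign {k} (insert m S) = (1 :: 'n frac)"
      by (intro inv_sign_lower_bound) auto
    moreover have "k \<notin> insert m S" using less by auto
    ultimately show ?thesis using wedge_family_insert_less[OF less, of X] by simp
  next
    case 2
    have "wedge (X m) (wedge_family X (insert m S)) = (\<lambda>T. 0)"
      unfolding wedge_family_insert_less[OF insert_less(1)] X_def
      by (rule wedge_vector_field_self)
    then show ?thesis using 2 by simp
  next
    case 3
    have m: "m \<notin> S" using insert_less(1) by auto
    \<comment> \<open>Passing \<open>X m\<close> adds the single inversion between \<open>k\<close>
      and \<open>m\<close>; the induction hypothesis treats the rest.\<close>
    have sign: "inv_sign {k} (insert m S) = (- inv_sign {k} S :: 'n frac)"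
    proof -
      have "{b \<in> insert m S. b < k} = insert m {b \<in> S. b < k}" using 3 by auto
      then show ?thesis using m by (simp add: inv_sign_singleton_left)
    qed
    have "wedge (X k) (wedge_family X (insert m S)) = (\<lambda>T. - wedge (X m) (wedge (X k) (wedge_family X S)) T)"
      unfolding wedge_family_insert_less[OF insert_less(1)] X_def
      by (rule ext) (rule wedge_vector_field_swap)
    also have "\<dots> = (\<lambda>T. if k \<in> insert m S then 0
        else inv_sign {k} (insert m S) * wedge_family X (insert k (insert m S)) T)"
    proof (cases "k \<in> S")
      case True
      then show ?thesis by (simp add: insert_less(2) wedge_0_right)
    next
      case False
      have "\<forall>s\<in>insert k S. m < s" and "k \<noteq> m" using 3 insert_less(1) by auto
      with wedge_family_insert_less[OF this(1), of X] show ?thesis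
        using False
        by (simp add: insert_less(2) wedge_scale_right sign insert_commute)
    qed
    finally show ?thesis .
  qed
qed

text \<open>The factors of \<open>A\<close> are merged into the product over \<open>B\<close> one at
  a time; a common index produces a repeated factor.\<close>

lemma wedge_wedge_family:
  fixes c :: "'n::{finite, linorder} \<Rightarrow> 'n \<Rightarrow> 'n frac"
  defines "X \<equiv> \<lambda>i. vector_field (c i)"
  shows "wedge (wedge_family X A) (wedge_family X B)
    = (\<lambda>T. if A \<inter> B = {} then inv_sign A B * wedge_family X (A \<union> B) T else 0)"
proof (induction A rule: finite_set_insert_less_induct)
  case empty
  then show ?case by (simp add: wedge_family_empty wedge_unit_left)
next
  case (insert_less m A)
  have m: "m \<notin> A" using insert_less(1) by auto
  have "wedge (wedge_family X (insert m A)) (wedge_family X B)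
      = wedge (X m) (wedge (wedge_family X A) (wedge_family X B))"
    by (simp add: wedge_family_insert_less insert_less(1) wedge_assoc)
  also have "\<dots> = (\<lambda>T. if insert m A \<inter> B = {}
      then inv_sign (insert m A) B * wedge_family X (insert m A \<union> B) T else 0)"
  proof (cases "A \<inter> B = {}")
    case True
    \<comment> \<open>The elements of \<open>A\<close> all exceed \<open>m\<close>, so only
      \<open>B\<close> contributes inversions with \<open>m\<close>.\<close>
    have "{b \<in> A \<union> B. b < m} = {b \<in> B. b < m}" using insert_less(1) by auto
    then have "inv_sign {m} (A \<union> B) = (inv_sign {m} B :: 'n frac)"
      by (simp add: inv_sign_singleton_left)
    moreover have "inv_sign (insert m A) B = (inv_sign {m} B * inv_sign A B :: 'n frac)"
      using m inv_sign_Un_left[of "{m}" A B] by simp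
    ultimately show ?thesis
      using True m wedge_vector_wedge_family[of c m "A \<union> B"]
      by (auto simp: X_def insert_less(2)[unfolded X_def] wedge_scale_right fun_eq_iff)
  next
    case False
    then show ?thesis by (auto simp: insert_less(2) wedge_0_right)
  qed
  finally show ?case .
qed

text \<open>For sets of equal size the sum is, up to sign, the top coefficient of the product of the
  columns \<open>I\<close> with the columns \<open>- J\<close>, where \<open>K\<close> splits the
  rows. For different sizes each summand contains a non-square minor.\<close>

lemma laplace_expansion_columns:
  fixes l :: "'n::{finite, linorder} \<Rightarrow> 'n \<Rightarrow> 'n frac"
  shows "(\<Sum>K\<in>UNIV. inv_sign J (- J) * inv_sign K (- K) * minor l (- K) (- J) * minor l K I)
    = (if I = J then det_of l else 0)"
proof (cases "card I = card J")
  case True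
  \<comment> \<open>These are the columns of \<open>l\<close>, so the components of their products
    are indexed by row sets.\<close>
  define X where "X = (\<lambda>j. vector_field (\<lambda>i. l i j))"
  have X: "wedge_family X I K = minor l K I" for I K
  proof (cases "card K = card I")
    case True
    then show ?thesis
      unfolding X_def wedge_family_vector_field by (rule minor_transpose)
  next
    case False
    then show ?thesis
      by (simp add: X_def wedge_family_vector_field minor_card_neq)
  qed
  have "(\<Sum>K\<in>UNIV. inv_sign K (- K) * minor l (- K) (- J) * minor l K I)
      = wedge (wedge_family X I) (wedge_family X (- J)) UNIV"
    by (simp add: wedge_eq X Compl_eq_Diff_UNIV mult_ac)
  also have "\<dots> = (if I \<inter> - J = {} then inv_sign I (- J) * minor l UNIV (I \<union> - J) else 0)"
    unfolding X_def wedge_wedge_family by (simp add: X[unfolded X_def])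
  also have "\<dots> = (if I = J then inv_sign J (- J) * det_of l else 0)"
  proof -
    \<comment> \<open>Disjointness from \<open>- J\<close> means \<open>I \<subseteq> J\<close>, and
      equal cardinalities force equality.\<close>
    have "I \<inter> - J = {} \<longleftrightarrow> I = J" using card_subset_eq[of J I] True by auto
    then show ?thesis by (auto simp: det_of_eq_minor)
  qed
  finally have "inv_sign J (- J) * (\<Sum>K\<in>UNIV. inv_sign K (- K) * minor l (- K) (- J) * minor l K I)
      = (if I = J then det_of l else 0)"
    by (simp flip: mult.assoc)
  then show ?thesis by (simp add: sum_distrib_left mult_ac)
next
  case False
  have "minor l (- K) (- J) = 0 \<or> minor l K I = 0" for K
  proof (cases "card K = card I")
    case True
    then have "card (- K) \<noteq> card (- J)"
      using False card_mono[of UNIV J] card_mono[of UNIV K] by (simp add: Compl_eq_Diff_UNIV card_Diff_subset)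
    then show ?thesis by (simp add: minor_card_neq)
  qed (simp add: minor_card_neq)
  then have "(\<Sum>K\<in>UNIV. inv_sign J (- J) * inv_sign K (- K) * minor l (- K) (- J) * minor l K I) = 0"
    by (intro sum.neutral) auto
  then show ?thesis using False by auto
qed

text \<open>Prepending a least index creates no inversion, so the ordered products are the
  coordinate vectors and the coefficients of a real cochain are its components.\<close>

lemma wedge_family_partial: "wedge_family partial = basis_polyvector"
proof (rule ext)
  fix K :: "'a set"
  have partial: "partial j = vector_field (\<lambda>i. if i = j then 1 else 0)" for j :: 'a
    by (simp add: vector_field_def lincomb_def if_distrib[of "\<lambda>x. x * _"] cong: if_cong)
  have wp: "wedge (partial k) (basis_polyvector K) = basis_polyvector (insert k K)"
    if "\<forall>s\<in>K. k < s" for k and K :: "'a set"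
  proof
    fix S
    have k: "k \<notin> K" using that by auto
    have "wedge (partial k) (basis_polyvector K) S
        = (\<Sum>s\<in>S. if s = k then inv_sign {k} S * basis_polyvector K (S - {k}) else 0)"
      unfolding partial wedge_vector_field by (rule sum.cong) auto
    also have "\<dots> = (if k \<in> S then inv_sign {k} S * basis_polyvector K (S - {k}) else 0)"
      by simp
    also have "\<dots> = basis_polyvector (insert k K) S"
    proof (cases "S = insert k K")
      case True
      then have "inv_sign {k} S = (1 :: 'a frac)"
        using that by (intro inv_sign_lower_bound) auto
      then show ?thesis using True k by (simp add: basis_polyvector_def)
    next
      case False
      then show ?thesis using k by (auto simp: basis_polyvector_def)
    qed
    finally show "wedge (partial k) (basis_polyvector K) S = basis_polyvector (insert k K) S" .
  qed
  show "wedge_family partial K = basis_polyvector K"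
    by (induction K rule: finite_set_insert_less_induct)
       (simp_all add: wedge_family_empty wedge_family_insert_less wp)
qed

lemma lincomb_basis_polyvector: "lincomb UNIV c basis_polyvector = c"
  by (simp add: lincomb_def basis_polyvector_def if_distrib[of "(*) _"] cong: if_cong)


section \<open>Real and potential cochains\<close>

lemma Y_field_eq: "Y_field l i = vector_field (\<lambda>r. frac_of_mpoly (l i r))"
  by (simp add: Y_field_def vector_field_def)

lemma wedge_family_Y_field: "wedge_family (Y_field l) K I = frac_of_mpoly (minor l K I)"
proof -
  have "Y_field l = (\<lambda>i. vector_field (\<lambda>r. frac_of_mpoly (l i r)))"
    by (rule ext) (rule Y_field_eq)
  then show ?thesis by (simp add: wedge_family_vector_field minor_frac_of_mpoly)
qed

text \<open>Both sides live on singletons, and at \<open>{r}\<close> the cofactor identity leaves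
  \<open>det_of l\<close> for \<open>j = r\<close> and 0 otherwise, divided by
  \<open>det_of l\<close>.\<close>

lemma partial_via_Y_eq:
  assumes "det_of l \<noteq> 0"
  shows "partial_via_Y l = partial"
proof (rule ext, rule ext)
  fix j :: 'a and S :: "'a set"
  let ?f = "frac_of_mpoly :: 'a mpoly \<Rightarrow> 'a frac"
  show "partial_via_Y l j S = partial j S"
  proof (cases "\<exists>r. S = {r}")
    case True
    then obtain r where r: "S = {r}" by blast
    have "partial_via_Y l j {r} = (\<Sum>k\<in>UNIV. ?f (cofactor_of l k j * l k r)) / ?f (det_of l)"
      by (simp add: partial_via_Y_def lincomb_def Y_field_eq frac_of_mpoly.hom_mult
          sum_divide_distrib)
    also have "\<dots> = ?f (if j = r then det_of l else 0) / ?f (det_of l)"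
      by (simp only: frac_of_mpoly.hom_sum[symmetric] sum_cofactor_mult)
    also have "\<dots> = partial j {r}"
      using assms by (auto simp: partial_def basis_polyvector_def)
    finally show ?thesis by (simp add: r)
  next
    case False
    then have "vector_field c S = 0" for c by (intro vector_field_eq_0) auto
    then show ?thesis
      using False by (auto simp: partial_via_Y_def lincomb_def Y_field_eq partial_def basis_polyvector_def)
  qed
qed

lemma real_to_potential_eq:
  "det_of l \<noteq> 0 \<Longrightarrow> real_to_potential l u = u"
  by (simp add: real_to_potential_def partial_via_Y_eq wedge_family_partial
      lincomb_basis_polyvector)

lemma real_cochains_eq: "real_cochains = {u. range u \<subseteq> range frac_of_mfps}"
proof -
  have "u \<in> real_cochains \<longleftrightarrow> (\<exists>f. \<forall>S. u S = frac_of_mfps (f S))" for u :: "'a polyvector"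
    by (auto simp: real_cochains_def wedge_family_partial lincomb_basis_polyvector)
  also have "\<dots> u \<longleftrightarrow> range u \<subseteq> range frac_of_mfps" for u :: "'a polyvector"
    by (auto simp: image_subset_iff image_iff intro: choice)
  finally show ?thesis by blast
qed

text \<open>\<open>D \<partial>\<^sub>J = \<Sum>\<^sub>K \<plusminus> L\<^bsup>K\<^sup>c J\<^sup>c\<^esup> Y\<^sub>K\<close>, by Laplace expansion along the columns \<open>J\<close>.\<close>

lemma real_cochains_subset_potential_cochains:
  fixes l :: "'n::{finite, linorder} \<Rightarrow> 'n \<Rightarrow> 'n mpoly"
  assumes "det_of l \<noteq> 0"
  shows "real_cochains \<subseteq> potential_cochains l"
proof
  fix u :: "'n polyvector" assume "u \<in> real_cochains"
  then obtain f where f: "\<And>S. u S = frac_of_mfps (f S)"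
    by (auto simp: real_cochains_def wedge_family_partial lincomb_basis_polyvector)
  let ?l = "\<lambda>i j. frac_of_mpoly (l i j)" and ?D = "frac_of_mpoly (det_of l)"
  \<comment> \<open>\<open>M J K\<close> is the coefficient of \<open>Y_K\<close> in
    \<open>D\<close> times \<open>\<partial>_J\<close>. It is a power series, so the coefficients
    \<open>g K\<close> below are power series and \<open>D\<close> is the only denominator.\<close>
  define M where "M J K = inv_sign J (- J) * inv_sign K (- K) * mfps_of_mpoly (minor l (- K) (- J))"
    for J K :: "'n set"
  have inv_sign: "frac_of_mfps (inv_sign A B) = inv_sign A B" for A B :: "'n set"
    by (simp add: inv_sign_def frac_of_mfps.hom_power frac_of_mfps.hom_uminus)
  have M: "frac_of_mfps (M J K) = inv_sign J (- J) * inv_sign K (- K) * minor ?l (- K) (- J)" for J K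
    by (simp add: M_def frac_of_mfps.hom_mult inv_sign minor_frac_of_mpoly flip: frac_of_mpoly_def)
  have sum_M: "(\<Sum>K\<in>UNIV. frac_of_mfps (M J K) * wedge_family (Y_field l) K I) = (if I = J then ?D else 0)"
    for I J
    unfolding M wedge_family_Y_field minor_frac_of_mpoly[symmetric] laplace_expansion_columns
    by (simp add: det_of_eq_minor minor_frac_of_mpoly)
  define g where "g K = (\<Sum>J\<in>UNIV. f J * M J K)" for K
  have "u = lincomb UNIV (\<lambda>K. frac_of_mfps (g K) / ?D) (wedge_family (Y_field l))"
  proof
    fix I
    have "lincomb UNIV (\<lambda>K. frac_of_mfps (g K) / ?D) (wedge_family (Y_field l)) I
        = (\<Sum>K\<in>UNIV. \<Sum>J\<in>UNIV. frac_of_mfps (f J) * (frac_of_mfps (M J K) * wedge_family (Y_field l) K I)) / ?D"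
      by (simp add: lincomb_def g_def frac_of_mfps.hom_sum frac_of_mfps.hom_mult
          sum_distrib_right sum_divide_distrib mult.assoc)
    \<comment> \<open>After exchanging the sums, the inner one over \<open>K\<close> is the Laplace
      expansion.\<close>
    also have "\<dots> = (\<Sum>J\<in>UNIV. frac_of_mfps (f J) * (if I = J then ?D else 0)) / ?D"
      by (subst sum.swap) (simp flip: sum_distrib_left add: sum_M)
    also have "\<dots> = u I"
      using assms by (simp add: f if_distrib[of "(*) _"] cong: if_cong)
    finally show "u I = lincomb UNIV (\<lambda>K. frac_of_mfps (g K) / ?D) (wedge_family (Y_field l)) I" ..
  qed
  then show "u \<in> potential_cochains l" unfolding potential_cochains_def by blast
qed

section \<open>Homogeneous potential cochains and the divisibility criterion\<close>

lemma homogeneous_det_of: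
  fixes l :: "'n::{finite, linorder} \<Rightarrow> 'n \<Rightarrow> 'n mpoly"
  assumes "\<forall>i r. homogeneous 1 (l i r)"
  shows "homogeneous CARD('n) (det_of l)"
  unfolding det_of_eq_minor using assms by (rule homogeneous_minor)

lemma homogeneous_potential_eq:
  assumes "card I = p"
  shows "homogeneous_potential l p P I
    = frac_of_mpoly (\<Sum>K | card K = p. minor l K I * P K) / frac_of_mpoly (det_of l)"
  by (simp add: homogeneous_potential_def lincomb_def wedge_family_Y_field
      frac_of_mpoly.hom_sum frac_of_mpoly.hom_mult sum_divide_distrib mult.commute)

lemma homogeneous_potential_eq_0:
  assumes "card I \<noteq> p"
  shows "homogeneous_potential l p P I = 0"
  using assms
  by (auto simp: homogeneous_potential_def lincomb_def wedge_family_Y_field minor_card_neq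
      intro!: sum.neutral)

lemma homogeneous_sum_minor_mult:
  fixes l :: "'n::{finite, linorder} \<Rightarrow> 'n \<Rightarrow> 'n mpoly"
  assumes "\<forall>i r. homogeneous 1 (l i r)" "\<forall>K. card K = p \<longrightarrow> homogeneous r (P K)"
  shows "homogeneous (p + r) (\<Sum>K | card K = p. minor l K I * P K)"
proof (rule homogeneous_sum)
  fix K :: "'n set" assume "K \<in> {K. card K = p}"
  then show "homogeneous (p + r) (minor l K I * P K)"
    using homogeneous_mult[OF homogeneous_minor[OF assms(1), of K I], of r "P K"] assms(2) by simp
qed

text \<open>Membership is tested component by component: in degree \<open>p\<close> by divisibility
  of the numerator, while in other degrees the component is 0 and so a power series.\<close>

lemma homogeneous_potential_in_real_cochains_iff:
  fixes l :: "'n::{finite, linorder} \<Rightarrow> 'n \<Rightarrow> 'n mpoly"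
  assumes l: "\<forall>i r. homogeneous 1 (l i r)" and D: "det_of l \<noteq> 0"
    and P: "\<forall>K. card K = p \<longrightarrow> homogeneous r (P K)"
  shows "homogeneous_potential l p P \<in> real_cochains
    \<longleftrightarrow> (\<forall>I. card I = p \<longrightarrow> det_of l dvd (\<Sum>K | card K = p. minor l K I * P K))"
proof -
  have "homogeneous_potential l p P I \<in> range frac_of_mfps
      \<longleftrightarrow> (card I = p \<longrightarrow> det_of l dvd (\<Sum>K | card K = p. minor l K I * P K))" for I
  proof (cases "card I = p")
    case True
    then show ?thesis
      using frac_of_mpoly_divide_in_mfps_iff[OF homogeneous_det_of[OF l]
          homogeneous_sum_minor_mult[OF l P] D]
      by (simp add: homogeneous_potential_eq)
  next
    case False
    then have "homogeneous_potential l p P I = frac_of_mfps 0"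
      by (simp add: homogeneous_potential_eq_0)
    then show ?thesis using False by blast
  qed
  then show ?thesis by (simp add: real_cochains_eq image_subset_iff)
qed

lemma potential_cochains_not_subset_real_cochains:
  fixes l :: "'n::{finite, linorder} \<Rightarrow> 'n \<Rightarrow> 'n mpoly"
  assumes l: "\<forall>i r. homogeneous 1 (l i r)" and D: "det_of l \<noteq> 0"
  shows "\<not> potential_cochains l \<subseteq> real_cochains"
proof
  assume sub: "potential_cochains l \<subseteq> real_cochains"
  \<comment> \<open>The witness \<open>1 / D\<close> in degree 0 is rewritten as a cochain of
    bidegree (0,0), so that the criterion would make \<open>D\<close> divide 1.\<close>
  define f :: "'n set \<Rightarrow> 'n mfps" where "f K = (if K = {} then 1 else 0)" for K
  have "lincomb UNIV (\<lambda>K. frac_of_mfps (f K) / frac_of_mpoly (det_of l)) (wedge_family (Y_field l))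
      \<in> potential_cochains l"
    unfolding potential_cochains_def by blast
  also have "lincomb UNIV (\<lambda>K. frac_of_mfps (f K) / frac_of_mpoly (det_of l)) (wedge_family (Y_field l))
      = homogeneous_potential l 0 (\<lambda>_. 1)"
  proof
    fix I
    have "(\<Sum>K\<in>UNIV. frac_of_mfps (f K) / frac_of_mpoly (det_of l) * wedge_family (Y_field l) K I)
        = (\<Sum>K\<in>{{}}. frac_of_mfps (f K) / frac_of_mpoly (det_of l) * wedge_family (Y_field l) K I)"
      by (rule sum.mono_neutral_right) (auto simp: f_def)
    then show "lincomb UNIV (\<lambda>K. frac_of_mfps (f K) / frac_of_mpoly (det_of l)) (wedge_family (Y_field l)) I
        = homogeneous_potential l 0 (\<lambda>_. 1) I"
      by (simp add: lincomb_def homogeneous_potential_def f_def)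
  qed
  finally have "homogeneous_potential l 0 (\<lambda>_. 1) \<in> real_cochains" using sub by blast
  then have "\<forall>I. card I = 0 \<longrightarrow> det_of l dvd (\<Sum>K | card K = 0. minor l K I * 1)"
    by (subst (asm) homogeneous_potential_in_real_cochains_iff[OF l D, of 0 0]) simp_all
  then have "det_of l dvd (\<Sum>K | card K = 0. minor l K {} * 1)" by (metis card.empty)
  then have "det_of l dvd 1" by (simp add: minor_empty)
  then obtain R where "1 = det_of l * R" ..
  then have "Poly_Mapping.lookup (det_of l * R) 0 = 1"
    by (metis lookup_one_zero)
  \<comment> \<open>A nonzero constant term of \<open>D * R\<close> needs a monomial
    \<open>a\<close> of \<open>D\<close> with \<open>a + b = 0\<close>, hence of degree 0, but
    \<open>D\<close> has degree \<open>CARD('n) > 0\<close>.\<close>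
  then obtain a b where "a + b = 0" "Poly_Mapping.lookup (det_of l) a \<noteq> 0"
    unfolding lookup_times_splittings
    by (metis (mono_tags, lifting) mult_eq_0_iff sum.neutral case_prodE mem_Collect_eq zero_neq_one case_prod_conv)
  then have "mdeg a + mdeg b = mdeg (0 :: 'n monomial)" and "mdeg a = CARD('n)"
    using homogeneous_det_of[OF l] by (metis mdeg_add, simp add: homogeneous_iff)
  then show False by (simp add: mdeg_def[of 0])
qed

theorem theorem3:
  fixes l :: "'n::{finite, linorder} \<Rightarrow> 'n \<Rightarrow> 'n mpoly"
  assumes "\<forall>i r. homogeneous 1 (l i r)"
    and "det_of l \<noteq> 0"
  shows "(real_to_potential l ` real_cochains \<subseteq> potential_cochains l
          \<and> inj_on (real_to_potential l) real_cochains
          \<and> real_to_potential l ` real_cochains \<noteq> potential_cochains l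
          \<and> (\<forall>u \<in> real_cochains. real_to_potential l u = u))
       \<and> (\<forall>p r P. p \<le> CARD('n) \<and> (\<forall>K. card K = p \<longrightarrow> homogeneous r (P K)) \<longrightarrow>
            card {I :: 'n set. card I = p} = fact CARD('n) div (fact p * fact (CARD('n) - p))
          \<and> (\<forall>I. card I = p \<longrightarrow>
               homogeneous (p + r) (\<Sum>K | card K = p. minor l K I * P K))
          \<and> (homogeneous_potential l p P \<in> real_to_potential l ` real_cochains
             \<longleftrightarrow> (\<forall>I. card I = p \<longrightarrow>
                    det_of l dvd (\<Sum>K | card K = p. minor l K I * P K))))"
proof -
  \<comment> \<open>With the map equal to the identity, the claims about its image become claims
    about \<open>real_cochains\<close> itself.\<close>
  have id: "real_to_potential l = (\<lambda>u. u)"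
    using real_to_potential_eq[OF assms(2)] by (rule ext)
  have card: "card {I :: 'n set. card I = p} = fact CARD('n) div (fact p * fact (CARD('n) - p))"
    if "p \<le> CARD('n)" for p
    using n_subsets[of "UNIV :: 'n set" p] binomial_fact'[OF that] by simp
  have "real_cochains \<subseteq> potential_cochains l" "real_cochains \<noteq> potential_cochains l"
    using real_cochains_subset_potential_cochains[OF assms(2)]
      potential_cochains_not_subset_real_cochains[OF assms] by auto
  then have "real_cochains \<subseteq> potential_cochains l \<and> inj_on (\<lambda>u. u) real_cochains
      \<and> real_cochains \<noteq> potential_cochains l \<and> (\<forall>u\<in>real_cochains. u = u)"
    by simp
  then show ?thesis
    unfolding id image_ident
    by (rule conjI)
       (intro allI impI, elim conjE, intro conjI allI impI,
        (erule card homogeneous_sum_minor_mult[OF assms(1)]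
          homogeneous_potential_in_real_cochains_iff[OF assms])+)
qed

end
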